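(* For $q$ ranging over prime powers, there exists an asymptotically optimal family of ideal $((q^2+1)\times(q+1),\,q+1,\,0,\,2)$ 2-D OOCs. That is, for every prime power $q$ there is a $((q^2+1)\times(q+1),q+1,0,2)$ 2-D OOC $C_q$ such that $$\lim_{q\to\infty}\frac{|C_q|}{J_q}=1,$$ where $J_q$ is the Johnson bound for ideal codes with these parameters.
   Context: A $(\Lambda\times T,w,\lambda_a,\lambda_c)$ 2-D optical orthogonal code (2-D OOC) is a set $C$ of $\Lambda\times T$ binary ($0/1$) arrays $A=(a_{i,j})$, $0\le i\le\Lambda-1$, $0\le j\le T-1$, each with exactly $w$ entries equal to $1$, such that (second subscript modulo $T$): (i) $\sum_{i,j}a_{i,j}a_{i,j+t}\le\lambda_a$ for every $A\in C$ and $1\le t\le T-1$; (ii) $\sum_{i,j}a_{i,j}b_{i,j+t}\le\lambda_c$ for all distinct $A,B\in C$ and $0\le t\le T-1$. The sums run over all $i,j$. The code is ideal if $\lambda_a=0$. The Johnson bound for ideal $(\Lambda\times T,w,0,\lambda_c)$ codes, with $N=\Lambda T$, is $\left\lfloor\frac{N}{Tw}\left\lfloor\frac{N-T}{w-1}\left\lfloor\cdots\left\lfloor\frac{N-\lambda_cT}{w-\lambda_c}\right\rfloor\cdots\right\rfloor\right\rfloor\right\rfloor$. For $\Lambda=q^2+1$, $T=w=q+1$, $\lambda_c=2$, $N=(q^2+1)(q+1)$ it is (for $q\ge2$) $$J_q=\left\lfloor\frac{N}{Tw}\left\lfloor\frac{N-T}{w-1}\left\lfloor\frac{N-2T}{w-2}\right\rfloor\right\rfloor\right\rfloor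 .$$ *)

theory Defs
  imports Complex_Main "HOL-Library.FuncSet" "HOL-Number_Theory.Prime_Powers"
begin

text \<open>
  A binary \<open>\<Lambda> \<times> T\<close> array is an extensional function on the index pairs, so that two arrays
  are equal iff their \<open>\<Lambda> * T\<close> entries agree; in particular there are only finitely many.
\<close>
definition binary_arrays :: "nat \<Rightarrow> nat \<Rightarrow> (nat \<times> nat \<Rightarrow> nat) set" where
  "binary_arrays \<Lambda> T = {..<\<Lambda>} \<times> {..<T} \<rightarrow>\<^sub>E {0, 1}"

definition array_weight :: "nat \<Rightarrow> nat \<Rightarrow> (nat \<times> nat \<Rightarrow> nat) \<Rightarrow> nat" where
  "array_weight \<Lambda> T A = card {p \<in> {..<\<Lambda>} \<times> {..<T}. A p = 1}"

definition correlation ::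
    "nat \<Rightarrow> nat \<Rightarrow> (nat \<times> nat \<Rightarrow> nat) \<Rightarrow> (nat \<times> nat \<Rightarrow> nat) \<Rightarrow> nat \<Rightarrow> nat" where
  "correlation \<Lambda> T A B t = (\<Sum>i<\<Lambda>. \<Sum>j<T. A (i, j) * B (i, (j + t) mod T))"

definition ooc_2d ::
    "nat \<Rightarrow> nat \<Rightarrow> nat \<Rightarrow> nat \<Rightarrow> nat \<Rightarrow> (nat \<times> nat \<Rightarrow> nat) set \<Rightarrow> bool" where
  "ooc_2d \<Lambda> T w la lc C \<longleftrightarrow>
     C \<subseteq> binary_arrays \<Lambda> T \<and>
     (\<forall>A\<in>C. array_weight \<Lambda> T A = w) \<and>
     (\<forall>A\<in>C. \<forall>t\<in>{1..<T}. correlation \<Lambda> T A A t \<le> la) \<and>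
     (\<forall>A\<in>C. \<forall>B\<in>C. A \<noteq> B \<longrightarrow> (\<forall>t\<in>{0..<T}. correlation \<Lambda> T A B t \<le> lc))"

definition ideal_ooc_2d ::
    "nat \<Rightarrow> nat \<Rightarrow> nat \<Rightarrow> nat \<Rightarrow> (nat \<times> nat \<Rightarrow> nat) set \<Rightarrow> bool" where
  "ideal_ooc_2d \<Lambda> T w lc C \<longleftrightarrow> ooc_2d \<Lambda> T w 0 lc C"

text \<open>
  The nested floors are built from the inside out: the fold starts at \<open>1\<close>, applies the factors
  with index \<open>lc, \<dots>, 1\<close> in this order, and the factor \<open>N / (T * w)\<close> comes last.
\<close>
definition johnson_bound_ideal :: "nat \<Rightarrow> nat \<Rightarrow> nat \<Rightarrow> nat \<Rightarrow> int" where
  "johnson_bound_ideal \<Lambda> T w lc =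
     (let N = real \<Lambda> * real T in
      \<lfloor>N / (real T * real w) *
        of_int (foldr (\<lambda>k x. \<lfloor>(N - real k * real T) / (real w - real k) * of_int x\<rfloor>)
                 [1..<Suc lc] 1)\<rfloor>)"

lemma johnson_bound_ideal_2:
  fixes \<Lambda> T w :: nat
  defines "N \<equiv> real \<Lambda> * real T"
  shows "johnson_bound_ideal \<Lambda> T w 2 =
    \<lfloor>N / (real T * real w) *
      of_int \<lfloor>(N - real T) / (real w - 1) * of_int \<lfloor>(N - 2 * real T) / (real w - 2)\<rfloor>\<rfloor>\<rfloor>"
  by (simp add: johnson_bound_ideal_def N_def Let_def upt_rec)

end

theory Submission
  imports Defs "HOL-Computational_Algebra.Polynomial" "HOL-Real_Asymp.Real_Asymp"
begin

text \<open>
  Let \<open>K\<close> be the field with \<open>q\<^sup>2\<close> elements and \<open>U\<close> its group of elements of norm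
  \<open>x * x ^ q = 1\<close>, which is cyclic of order \<open>q + 1\<close>. Rows are labelled by elements of \<open>K\<close> and
  columns by elements of \<open>U\<close>, so that a cyclic shift of the columns is multiplication by an
  element of \<open>U\<close>. A codeword is the graph of a function from a circle
  \<open>{x. (x - c) ^ (q + 1) = s} = c + a * U\<close> to \<open>U\<close>, namely \<open>c + a * x \<mapsto> (x - b ^ q) / (1 - b * x)\<close>
  for some \<open>b\<close> with \<open>b ^ (q + 1) \<noteq> 1\<close>. Such a graph has \<open>q + 1\<close> entries, all in different rows,
  so it is disjoint from all its nontrivial shifts: the code is ideal.

  The bound \<open>2\<close> for the cross-correlation comes from counting roots of quadratic polynomials.
  Two different circles share at most two rows: eliminating \<open>x ^ q\<close> from their two equations leaves
  a quadratic equation for \<open>x\<close> (\<open>circles_meet_in_at_most_two\<close>). On a common circle, two of the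
  Moebius functions, one of them multiplied by an element of \<open>U\<close>, agree where a quadratic
  polynomial vanishes, and this polynomial is zero only if both functions have the same \<open>b\<close>
  (\<open>columns_agree_at_most_twice\<close>).

  There are \<open>q\<^sup>2\<close> centres and \<open>q - 1\<close> radii, and \<open>b\<close> ranges over \<open>(q + 1) * (q - 2)\<close> nonzero
  elements, so that the code has \<open>q\<^sup>2 * (q - 1) * (q + 1) * (q - 2)\<close> words. The Johnson bound is
  \<open>q * (q\<^sup>2 + 1) * (q + 1)\<^sup>2\<close>; both are asymptotic to \<open>q ^ 5\<close>.

  The field depends on the value of the variable \<open>q\<close>, so it cannot be a type. It is represented
  by polynomials with integer coefficients up to congruence modulo a prime ideal \<open>P\<close>. The ideal
  has to contain the characteristic \<open>p\<close> and to give the indeterminate the exact multiplicative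
  order \<open>q\<^sup>2 - 1\<close>; the powers of the indeterminate are then all nonzero elements of the field.
  The existence of \<open>P\<close> (\<open>prime_ideal_with_root_of_unity\<close>) is a Krull-type argument whose
  hypothesis is verified by evaluating polynomials at the complex roots of unity.
\<close>

section \<open>Congruence modulo a prime ideal\<close>

definition ring_ideal :: "'r::comm_ring_1 set \<Rightarrow> bool" where
  "ring_ideal I \<longleftrightarrow> 0 \<in> I \<and> (\<forall>x\<in>I. \<forall>y\<in>I. x + y \<in> I) \<and> (\<forall>r. \<forall>x\<in>I. r * x \<in> I)"

locale mod_prime_ideal =
  fixes P :: "'r::comm_ring_1 set"
  assumes ideal: "ring_ideal P"
    and one_notin: "1 \<notin> P"
    and prime: "x * y \<in> P \<Longrightarrow> x \<in> P \<or> y \<in> P"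
begin

definition eqv :: "'r \<Rightarrow> 'r \<Rightarrow> bool"  (infix \<open>\<approx>\<close> 50) where
  "x \<approx> y \<longleftrightarrow> x - y \<in> P"

lemma zero_in [simp]: "0 \<in> P"
  and add_in: "x \<in> P \<Longrightarrow> y \<in> P \<Longrightarrow> x + y \<in> P"
  and mult_in: "x \<in> P \<Longrightarrow> r * x \<in> P"
  using ideal by (auto simp: ring_ideal_def)

lemma mult_in': "x \<in> P \<Longrightarrow> x * r \<in> P"
  using mult_in[of x r] by (simp add: mult.commute)

lemma uminus_in: "x \<in> P \<Longrightarrow> - x \<in> P"
  using mult_in[of x "-1"] by simp

lemma diff_in: "x \<in> P \<Longrightarrow> y \<in> P \<Longrightarrow> x - y \<in> P"
  using add_in[of x "-y"] uminus_in[of y] by simp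

lemma sum_in: "(\<And>i. i \<in> I \<Longrightarrow> f i \<in> P) \<Longrightarrow> sum f I \<in> P"
  by (induction I rule: infinite_finite_induct) (auto intro: add_in)

lemma mult_in_iff: "x * y \<in> P \<longleftrightarrow> x \<in> P \<or> y \<in> P"
  using prime mult_in mult_in' by blast

lemma power_in_iff: "x ^ n \<in> P \<longleftrightarrow> n > 0 \<and> x \<in> P"
  by (induction n) (auto simp: one_notin mult_in_iff)

lemma eqv_refl [simp]: "x \<approx> x"
  by (simp add: eqv_def)

lemma eqv_sym: "x \<approx> y \<Longrightarrow> y \<approx> x"
  using uminus_in[of "x - y"] by (simp add: eqv_def)

lemma eqv_trans [trans]: "x \<approx> y \<Longrightarrow> y \<approx> z \<Longrightarrow> x \<approx> z"
  using add_in[of "x - y" "y - z"] by (simp add: eqv_def)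

lemma eqv_add: "a \<approx> b \<Longrightarrow> c \<approx> d \<Longrightarrow> a + c \<approx> b + d"
  using add_in[of "a - b" "c - d"] by (simp add: eqv_def algebra_simps)

lemma eqv_diff: "a \<approx> b \<Longrightarrow> c \<approx> d \<Longrightarrow> a - c \<approx> b - d"
  using diff_in[of "a - b" "c - d"] by (simp add: eqv_def algebra_simps)

lemma eqv_mult: "a \<approx> b \<Longrightarrow> c \<approx> d \<Longrightarrow> a * c \<approx> b * d"
  using add_in[OF mult_in[of "c - d" a] mult_in[of "a - b" d]]
  by (simp add: eqv_def algebra_simps)

lemma eqv_power: "a \<approx> b \<Longrightarrow> a ^ n \<approx> b ^ n"
  by (induction n) (auto intro: eqv_mult)

lemma eqv_zero_iff: "x \<approx> 0 \<longleftrightarrow> x \<in> P"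
  by (simp add: eqv_def)

lemma eqv_in_iff: "x \<approx> y \<Longrightarrow> x \<in> P \<longleftrightarrow> y \<in> P"
  using eqv_sym eqv_trans eqv_zero_iff by meson

lemma eqv_cancel: "x * y \<approx> x * z \<Longrightarrow> x \<notin> P \<Longrightarrow> y \<approx> z"
  using prime[of x "y - z"] by (simp add: eqv_def algebra_simps)

text \<open>
  A polynomial of degree \<open>d\<close> with more than \<open>d\<close> roots is zero over an integral domain; this is
  the same statement for the residue ring modulo \<open>P\<close>, phrased with representatives. Splitting off
  a linear factor by synthetic division makes the induction work: the factor \<open>x - c\<close> is not in
  \<open>P\<close> at the remaining roots.
\<close>
lemma coeffs_in_if_many_roots:
  assumes "degree f < card S"
    and "\<And>x. x \<in> S \<Longrightarrow> poly f x \<in> P"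
    and "\<And>x y. x \<in> S \<Longrightarrow> y \<in> S \<Longrightarrow> x \<noteq> y \<Longrightarrow> \<not> x \<approx> y"
  shows "coeff f i \<in> P"
  using assms
proof (induction "card S" arbitrary: f S i)
  case 0
  then show ?case by simp
next
  case (Suc n)
  from Suc.hyps(2) obtain c where c: "c \<in> S"
    by (metis card.empty equals0I nat.distinct(1))
  have fc: "poly f c \<in> P"
    using Suc.prems(2) c by blast
  show ?case
  proof (cases "degree f = 0")
    case True
    then obtain a where "f = [:a:]"
      by (rule degree_eq_zeroE)
    with fc show ?thesis
      by (cases i) auto
  next
    case False
    define h where "h = synthetic_div f c"
    have f: "f = [:- c, 1:] * h + [:poly f c:]"
      unfolding h_def by (rule synthetic_div_correct'[symmetric])
    have card: "n = card (S - {c})"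
      using Suc.hyps(2) c by simp
    have "coeff h j \<in> P" for j
    proof (rule Suc.hyps(1)[OF card])
      show "degree h < card (S - {c})"
        using Suc.prems(1) Suc.hyps(2) False card
        by (simp add: h_def degree_synthetic_div)
    next
      fix x assume x: "x \<in> S - {c}"
      have "(x - c) * poly h x + poly f c = poly f x"
        using arg_cong[OF f, of "\<lambda>g. poly g x"] by (simp add: algebra_simps)
      then have "(x - c) * poly h x = poly f x - poly f c"
        by (simp add: algebra_simps)
      then have "(x - c) * poly h x \<in> P"
        using diff_in[OF Suc.prems(2)[of x] fc] x by simp
      moreover have "x - c \<notin> P"
        using Suc.prems(3)[of x c] x c by (auto simp: eqv_def)
      ultimately show "poly h x \<in> P"
        using prime by blast
    qed (use Suc.prems(3) in auto)
    then show ?thesis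
      by (subst f) (use fc in \<open>auto simp: coeff_pCons split: nat.split
        intro!: add_in diff_in uminus_in mult_in\<close>)
  qed
qed

lemma freshmans_dream_mod:
  assumes "prime (p::nat)" "of_nat p \<in> P"
  shows "(x + y) ^ p \<approx> x ^ p + y ^ p"
proof -
  have p: "p > 0" using assms(1) by (simp add: prime_gt_0_nat)
  define t where "t k = of_nat (p choose k) * x ^ k * y ^ (p - k)" for k
  have "(x + y) ^ p = (\<Sum>k\<le>p. t k)"
    by (simp add: t_def binomial_ring)
  also have "{..p} = insert 0 (insert p {1..<p})" using p by auto
  also have "(\<Sum>k\<in>\<dots>. t k) = x ^ p + y ^ p + (\<Sum>k\<in>{1..<p}. t k)"
    using p by (simp add: t_def)
  finally have "(x + y) ^ p - (x ^ p + y ^ p) = (\<Sum>k\<in>{1..<p}. t k)" by simp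
  moreover have "t k \<in> P" if "k \<in> {1..<p}" for k
  proof -
    have "p dvd (p choose k)"
      using that assms(1) by (intro dvd_choose_prime) auto
    then obtain m where m: "p choose k = p * m" by (rule dvdE)
    show ?thesis unfolding t_def m of_nat_mult
      by (intro mult_in' assms(2))
  qed
  ultimately show ?thesis
    unfolding eqv_def by (metis (no_types, lifting) sum_in)
qed

lemma freshmans_dream_mod_power:
  assumes "prime (p::nat)" "of_nat p \<in> P"
  shows "(x + y) ^ (p ^ m) \<approx> x ^ (p ^ m) + y ^ (p ^ m)"
proof (induction m)
  case (Suc m)
  have "(x + y) ^ (p ^ Suc m) = ((x + y) ^ (p ^ m)) ^ p"
    by (simp add: power_mult[symmetric] mult.commute)
  also have "\<dots> \<approx> (x ^ (p ^ m) + y ^ (p ^ m)) ^ p"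
    by (rule eqv_power[OF Suc])
  also have "\<dots> \<approx> (x ^ (p ^ m)) ^ p + (y ^ (p ^ m)) ^ p"
    by (rule freshmans_dream_mod[OF assms])
  also have "\<dots> = x ^ (p ^ Suc m) + y ^ (p ^ Suc m)"
    by (simp add: power_mult[symmetric] mult.commute)
  finally show ?case .
qed simp

end

text \<open>
  The ideal generated by \<open>I\<close> and \<open>x\<close>.
\<close>
lemma ring_ideal_add_multiples:
  assumes "ring_ideal I"
  shows "ring_ideal {y + r * x |y r. y \<in> I}"
  unfolding ring_ideal_def
proof (intro conjI ballI allI)
  have "0 \<in> I" using assms by (simp add: ring_ideal_def)
  then show "0 \<in> {y + r * x |y r. y \<in> I}" by (auto intro!: exI[of _ 0])
next
  fix a b assume "a \<in> {y + r * x |y r. y \<in> I}" "b \<in> {y + r * x |y r. y \<in> I}"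
  then obtain y r y' r' where *: "a = y + r * x" "b = y' + r' * x" "y \<in> I" "y' \<in> I" by auto
  then have "a + b = (y + y') + (r + r') * x" by (simp add: algebra_simps)
  moreover have "y + y' \<in> I" using * assms by (simp add: ring_ideal_def)
  ultimately show "a + b \<in> {y + r * x |y r. y \<in> I}" by blast
next
  fix s a assume "a \<in> {y + r * x |y r. y \<in> I}"
  then obtain y r where *: "a = y + r * x" "y \<in> I" by auto
  then have "s * a = s * y + (s * r) * x" by (simp add: algebra_simps)
  moreover have "s * y \<in> I" using * assms by (simp add: ring_ideal_def)
  ultimately show "s * a \<in> {y + r * x |y r. y \<in> I}" by blast
qed

text \<open>
  An ideal that is maximal among those avoiding all powers of \<open>e\<close> is prime: if neither \<open>x\<close> nor
  \<open>y\<close> were in it, then enlarging it by \<open>x\<close> and by \<open>y\<close> would catch a power of \<open>e\<close> each time, and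
  the product of the two would lie in the ideal as soon as \<open>x * y\<close> does.
\<close>
lemma prime_ideal_avoiding_powers:
  fixes e :: "'r::comm_ring_1"
  assumes J: "ring_ideal J" and e: "\<And>k. e ^ k \<notin> J"
  shows "\<exists>P. mod_prime_ideal P \<and> J \<subseteq> P \<and> e \<notin> P"
proof -
  define \<A> where "\<A> = {I. ring_ideal I \<and> J \<subseteq> I \<and> (\<forall>k. e ^ k \<notin> I)}"
  have "\<exists>M\<in>\<A>. \<forall>X\<in>\<A>. M \<subseteq> X \<longrightarrow> X = M"
  proof (rule subset_Zorn_nonempty)
    show "\<A> \<noteq> {}" using J e by (auto simp: \<A>_def)
  next
    fix \<C> assume ne: "\<C> \<noteq> {}" and ch: "subset.chain \<A> \<C>"
    have sub: "\<C> \<subseteq> \<A>" and cmp: "\<And>X Y. X \<in> \<C> \<Longrightarrow> Y \<in> \<C> \<Longrightarrow> X \<subseteq> Y \<or> Y \<subseteq> X"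
      using ch by (auto simp: subset_chain_def)
    have id: "\<And>X. X \<in> \<C> \<Longrightarrow> ring_ideal X" using sub by (auto simp: \<A>_def)
    have "ring_ideal (\<Union>\<C>)"
      unfolding ring_ideal_def
    proof (intro conjI ballI allI)
      show "0 \<in> \<Union>\<C>" using ne id by (auto simp: ring_ideal_def)
    next
      fix x y assume "x \<in> \<Union>\<C>" "y \<in> \<Union>\<C>"
      then obtain X Y where XY: "X \<in> \<C>" "Y \<in> \<C>" "x \<in> X" "y \<in> Y" by auto
      with cmp[of X Y] obtain Z where "Z \<in> \<C>" "x \<in> Z" "y \<in> Z" by auto
      then show "x + y \<in> \<Union>\<C>" using id[of Z] by (auto simp: ring_ideal_def)
    next
      fix r x assume "x \<in> \<Union>\<C>"
      then show "r * x \<in> \<Union>\<C>" using id unfolding ring_ideal_def by blast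
    qed
    moreover have "J \<subseteq> \<Union>\<C>" using ne sub by (auto simp: \<A>_def)
    moreover have "\<forall>k. e ^ k \<notin> \<Union>\<C>" using sub by (auto simp: \<A>_def)
    ultimately show "\<Union>\<C> \<in> \<A>" by (simp add: \<A>_def)
  qed
  then obtain P where P: "ring_ideal P" "J \<subseteq> P" "\<And>k. e ^ k \<notin> P"
    and max: "\<And>X. X \<in> \<A> \<Longrightarrow> P \<subseteq> X \<Longrightarrow> X = P"
    by (auto simp: \<A>_def)
  have power_in: "\<exists>k y r. y \<in> P \<and> e ^ k = y + r * x" if "x \<notin> P" for x
  proof (rule ccontr)
    assume no: "\<not> ?thesis"
    let ?X = "{y + r * x |y r. y \<in> P}"
    have sub: "P \<subseteq> ?X"
    proof
      fix y assume "y \<in> P"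
      then have "y + 0 * x \<in> ?X" by blast
      then show "y \<in> ?X" by simp
    qed
    have "?X \<in> \<A>"
      unfolding \<A>_def using ring_ideal_add_multiples[OF P(1)] P(2) sub no by auto
    then have "?X = P" using max sub by blast
    moreover have "x \<in> ?X"
    proof -
      have "0 \<in> P" using P(1) by (simp add: ring_ideal_def)
      then have "0 + 1 * x \<in> ?X" by blast
      then show ?thesis by simp
    qed
    ultimately show False using that by blast
  qed
  have "mod_prime_ideal P"
  proof
    show "ring_ideal P" by fact
    show "1 \<notin> P" using P(3)[of 0] by simp
    fix x y assume xy: "x * y \<in> P"
    show "x \<in> P \<or> y \<in> P"
    proof (rule ccontr)
      assume "\<not> ?thesis"
      then obtain k a r l b s where
        *: "a \<in> P" "e ^ k = a + r * x" "b \<in> P" "e ^ l = b + s * y"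
        using power_in by (metis (no_types))
      have "e ^ (k + l) = (b + s * y) * a + (r * x) * b + (r * s) * (x * y)"
        by (simp add: power_add * algebra_simps)
      also have "\<dots> \<in> P" using P(1) * xy by (simp add: ring_ideal_def)
      finally show False using P(3) by blast
    qed
  qed
  moreover have "e \<notin> P" using P(3)[of 1] by simp
  ultimately show ?thesis using P(2) by blast
qed

section \<open>A prime ideal modulo which the indeterminate has a given order\<close>

definition eval_int_poly :: "complex \<Rightarrow> int poly \<Rightarrow> complex" where
  "eval_int_poly z f = poly (map_poly of_int f) z"

lemma eval_int_poly_pCons [simp]:
  "eval_int_poly z (pCons c f) = of_int c + z * eval_int_poly z f"
  by (simp add: eval_int_poly_def map_poly_pCons)

lemma eval_int_poly_0 [simp]: "eval_int_poly z 0 = 0"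
  by (simp add: eval_int_poly_def)

lemma eval_int_poly_1 [simp]: "eval_int_poly z 1 = 1"
  by (simp add: one_pCons)

lemma eval_int_poly_add [simp]: "eval_int_poly z (f + g) = eval_int_poly z f + eval_int_poly z g"
  by (induction f g rule: poly_induct2) (simp_all add: algebra_simps)

lemma eval_int_poly_smult [simp]: "eval_int_poly z (smult c f) = of_int c * eval_int_poly z f"
  by (induction f rule: pCons_induct) (simp_all add: algebra_simps)

lemma eval_int_poly_mult [simp]: "eval_int_poly z (f * g) = eval_int_poly z f * eval_int_poly z g"
  by (induction f rule: pCons_induct) (simp_all add: algebra_simps)

lemma eval_int_poly_diff [simp]: "eval_int_poly z (f - g) = eval_int_poly z f - eval_int_poly z g"
  using eval_int_poly_add[of z "f - g" g] by (simp add: algebra_simps)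

lemma eval_int_poly_power [simp]: "eval_int_poly z (f ^ n) = eval_int_poly z f ^ n"
  by (induction n) simp_all

lemma eval_int_poly_prod [simp]:
  "eval_int_poly z (\<Prod>i\<in>I. f i) = (\<Prod>i\<in>I. eval_int_poly z (f i))"
  by (induction I rule: infinite_finite_induct) simp_all

lemma eval_int_poly_of_nat [simp]: "eval_int_poly z (of_nat n) = of_nat n"
  by (induction n) simp_all

text \<open>
  Only the integrality of the power sums of the \<open>w ^ j\<close> matters: they are \<open>N\<close> or \<open>0\<close>.
\<close>
lemma sum_eval_int_poly_roots_unity:
  fixes w :: complex
  assumes "w ^ N = 1"
  shows "(\<Sum>j<N. eval_int_poly (w ^ j) f) \<in> \<int>"
proof -
  have power_sum: "(\<Sum>j<N. (w ^ j) ^ i) \<in> \<int>" for i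
  proof (cases "w ^ i = 1")
    case True
    have "(w ^ j) ^ i = (w ^ i) ^ j" for j
      by (simp add: power_mult[symmetric] mult.commute)
    with True show ?thesis by simp
  next
    case False
    have "(\<Sum>j<N. (w ^ j) ^ i) = (\<Sum>j<N. (w ^ i) ^ j)"
      by (simp add: power_mult[symmetric] mult.commute)
    also have "\<dots> = ((w ^ i) ^ N - 1) / (w ^ i - 1)"
      using False by (simp add: geometric_sum)
    also have "(w ^ i) ^ N = (w ^ N) ^ i"
      by (simp add: power_mult[symmetric] mult.commute)
    finally show ?thesis using assms by simp
  qed
  have "(\<Sum>j<N. eval_int_poly (w ^ j) f) =
      (\<Sum>i\<le>degree f. of_int (coeff f i) * (\<Sum>j<N. (w ^ j) ^ i))"
    by (simp add: eval_int_poly_def poly_altdef sum_distrib_left sum.swap[of _ "{..<N}"]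
        degree_map_poly coeff_map_poly)
  also have "\<dots> \<in> \<int>"
    by (intro Ints_sum Ints_mult power_sum) auto
  finally show ?thesis .
qed

text \<open>
  The polynomials \<open>1 + X + \<dots> + X ^ (N - 1)\<close> and \<open>\<Prod>i\<in>{1..<N}. X - z ^ i\<close> are monic with the same
  simple roots, hence equal; the identity is their common value at \<open>1\<close>.
\<close>
lemma prod_one_minus_primitive_root_powers:
  fixes z :: complex
  assumes N: "N > 0" and z: "z ^ N = 1" and prim: "\<And>i. 0 < i \<Longrightarrow> i < N \<Longrightarrow> z ^ i \<noteq> 1"
  shows "(\<Prod>i\<in>{1..<N}. 1 - z ^ i) = of_nat N"
proof -
  have z0: "z \<noteq> 0" using z N by (auto simp: power_0_left)
  have le: "i = j" if "z ^ i = z ^ j" "i \<le> j" "j < N" for i j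
  proof -
    have "z ^ j = z ^ i * z ^ (j - i)" using that(2) by (simp add: power_add[symmetric])
    then have "z ^ (j - i) = 1" using that z0 by simp
    then show ?thesis using prim[of "j - i"] that by (cases "j = i") auto
  qed
  have inj: "inj_on (\<lambda>i. z ^ i) {1..<N}"
    by (rule inj_onI) (metis atLeastLessThan_iff le nat_le_linear)
  define F where "F = (\<Sum>i<N. monom (1::complex) i)"
  define G where "G = (\<Prod>i\<in>{1..<N}. [:- (z ^ i), 1:])"
  have degF: "degree F \<le> N - 1"
    unfolding F_def by (rule degree_sum_le) (auto intro: order.trans[OF degree_monom_le])
  have cF: "coeff F (N - 1) = 1"
    using N by (simp add: F_def coeff_sum)
  have degG: "degree G = N - 1"
    unfolding G_def by (subst degree_prod_eq_sum_degree) auto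
  have cG: "coeff G (N - 1) = 1"
    using lead_coeff_prod[of "\<lambda>i. [:- (z ^ i), 1:]" "{1..<N}"] degG by (simp add: G_def)
  have "F = G"
  proof (rule ccontr)
    assume ne: "F \<noteq> G"
    have "degree (F - G) \<le> N - 1"
      by (rule degree_diff_le) (use degF degG in auto)
    moreover have "degree (F - G) \<noteq> N - 1"
      using cF cG ne leading_coeff_0_iff[of "F - G"] by auto
    ultimately have "degree (F - G) < N - 1" by simp
    moreover have "(\<lambda>i. z ^ i) ` {1..<N} \<subseteq> {x. poly (F - G) x = 0}"
    proof safe
      fix i assume i: "i \<in> {1..<N}"
      then have "z ^ i \<noteq> 1" using prim by simp
      then have "poly F (z ^ i) = ((z ^ i) ^ N - 1) / (z ^ i - 1)"
        by (simp add: F_def poly_sum poly_monom geometric_sum)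
      also have "(z ^ i) ^ N = (z ^ N) ^ i"
        by (simp add: power_mult[symmetric] mult.commute)
      finally have "poly F (z ^ i) = 0" using z by simp
      moreover have "poly G (z ^ i) = 0"
        using i by (auto simp: G_def poly_prod)
      ultimately show "poly (F - G) (z ^ i) = 0" by simp
    qed
    then have "card ((\<lambda>i. z ^ i) ` {1..<N}) \<le> card {x. poly (F - G) x = 0}"
      using ne by (intro card_mono poly_roots_finite) auto
    moreover have "card {x. poly (F - G) x = 0} \<le> degree (F - G)"
      using ne by (intro card_poly_roots_bound) auto
    ultimately show False using card_image[OF inj] by simp
  qed
  then have "poly G 1 = poly F 1" by simp
  then show ?thesis
    by (simp add: F_def G_def poly_prod poly_sum poly_monom)
qed

text \<open>
  The purpose of this polynomial is to separate primitive from other roots of unity: at an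
  \<open>N\<close>-th root of unity it takes the value \<open>N\<close> or \<open>0\<close> according to whether the root is primitive.
  A prime ideal avoids it iff it avoids all the differences \<open>1 - X ^ i\<close> with \<open>0 < i < N\<close>.
\<close>
definition nonprimitive_product :: "nat \<Rightarrow> int poly" where
  "nonprimitive_product N = (\<Prod>i\<in>{1..<N}. 1 - monom 1 i)"

lemma eval_nonprimitive_product:
  "eval_int_poly z (nonprimitive_product N) = (\<Prod>i\<in>{1..<N}. 1 - z ^ i)"
proof -
  have "eval_int_poly z (monom 1 i) = z ^ i" for i
    using eval_int_poly_power[of z "monom 1 1" i] by (simp add: monom_power monom_altdef)
  then show ?thesis by (simp add: nonprimitive_product_def)
qed

text \<open>
  No power of the product lies in the ideal generated by \<open>p\<close> and \<open>X ^ N - 1\<close>. Otherwise the \<open>m\<close>-th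
  power of the relation shows that summing powers of the product over all \<open>N\<close>-th roots of unity
  yields multiples of \<open>p ^ m\<close>. These sums are the number of primitive roots times a power
  of \<open>N\<close>, so \<open>p ^ m\<close> would divide that number for every \<open>m\<close>.
\<close>
lemma nonprimitive_product_power_notin:
  assumes N: "N > 1" and p: "prime p" and cop: "coprime p N"
  shows "nonprimitive_product N ^ Suc k \<noteq> of_nat p * a + (monom 1 N - 1) * b"
proof
  assume eq: "nonprimitive_product N ^ Suc k = of_nat p * a + (monom 1 N - 1) * b"
  define w where "w = cis (2 * pi / real N)"
  have wN: "w ^ N = 1" using N by (simp add: w_def DeMoivre)
  have w_ne: "w ^ i \<noteq> 1" if "0 < i" "i < N" for i
  proof
    assume "w ^ i = 1"
    then have "cis (2 * pi * real i / real N) = cis (2 * pi * real 0 / real N)"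
      by (simp add: w_def DeMoivre algebra_simps)
    moreover have "inj_on (\<lambda>k. cis (2 * pi * real k / real N)) {..<N}"
      using bij_betw_roots_unity[of N] N by (simp add: bij_betw_def)
    ultimately show False using that inj_onD[of _ "{..<N}" i 0] by fastforce
  qed
  \<comment> \<open>\<open>Q\<close> holds the exponents of the primitive roots.\<close>
  define Q where "Q = {j\<in>{..<N}. \<forall>i\<in>{1..<N}. (w ^ j) ^ i \<noteq> 1}"
  have finQ: "finite Q" by (simp add: Q_def)
  have Q1: "1 \<in> Q" using w_ne N by (auto simp: Q_def)
  have wj: "(w ^ j) ^ N = 1" for j
    using wN by (metis mult.commute power_mult power_one)
  have val: "eval_int_poly (w ^ j) (nonprimitive_product N) = (if j \<in> Q then of_nat N else 0)"
    if "j < N" for j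
  proof (cases "j \<in> Q")
    case True
    then show ?thesis
      using prod_one_minus_primitive_root_powers[of N "w ^ j"] wj N
      by (auto simp: eval_nonprimitive_product Q_def)
  next
    case False
    then obtain i where "i \<in> {1..<N}" "(w ^ j) ^ i = 1" using \<open>j < N\<close> by (auto simp: Q_def)
    then show ?thesis using False
      by (auto simp: eval_nonprimitive_product intro!: bexI[of _ i])
  qed
  have val': "eval_int_poly (w ^ j) (nonprimitive_product N) ^ Suc k = of_nat p * eval_int_poly (w ^ j) a"
    for j
  proof -
    have "eval_int_poly (w ^ j) (monom 1 N) = 1"
      using eval_int_poly_power[of "w ^ j" "monom 1 1" N] wj[of j] by (simp add: monom_power monom_altdef)
    then show ?thesis
      using arg_cong[OF eq, of "eval_int_poly (w ^ j)"] by simp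
  qed
  define E where "E = nonprimitive_product N"
  have dvd: "p ^ m dvd card Q" for m
  proof -
    obtain s where s: "(\<Sum>j<N. eval_int_poly (w ^ j) (a ^ m * E)) = of_int s"
      using sum_eval_int_poly_roots_unity[OF wN, of "a ^ m * E"] by (auto elim: Ints_cases)
    \<comment> \<open>The extra factor \<open>E\<close> keeps the exponent \<open>K\<close> positive, also for \<open>m = 0\<close>, so that the terms of
        nonprimitive roots vanish.\<close>
    define K where "K = Suc k * m + 1"
    have "of_int (int p ^ m * s) = of_nat p ^ m * (\<Sum>j<N. eval_int_poly (w ^ j) (a ^ m * E))"
      unfolding s by simp
    also have "\<dots> = (\<Sum>j<N. (of_nat p * eval_int_poly (w ^ j) a) ^ m * eval_int_poly (w ^ j) E)"
      by (simp add: sum_distrib_left power_mult_distrib mult.assoc)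
    also have "\<dots> = (\<Sum>j<N. eval_int_poly (w ^ j) E ^ K)"
      unfolding K_def power_add power_mult power_one_right E_def val' ..
    also have "\<dots> = (\<Sum>j<N. if j \<in> Q then of_nat N ^ K else 0)"
      by (intro sum.cong refl) (simp add: E_def val K_def)
    also have "\<dots> = of_nat (card Q) * of_nat N ^ K"
    proof -
      have "{..<N} \<inter> Q = Q" by (auto simp: Q_def)
      then show ?thesis by (simp add: sum.If_cases)
    qed
    also have "\<dots> = of_int (int (card Q * N ^ K))" by simp
    finally have "int p ^ m * s = int (card Q * N ^ K)"
      by (simp only: of_int_eq_iff)
    then have "int (p ^ m) dvd int (card Q * N ^ K)"
      by (metis dvd_triv_left of_nat_power)
    then have "p ^ m dvd card Q * N ^ K" by (simp only: int_dvd_int_iff)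
    moreover have "coprime (p ^ m) (N ^ K)" using cop by simp
    ultimately show ?thesis using coprime_dvd_mult_left_iff by blast
  qed
  have "card Q > 0" using finQ Q1 card_gt_0_iff by blast
  moreover have "card Q < p ^ card Q"
    using p prime_ge_2_nat by (intro power_gt_expt) (auto simp: prime_nat_iff)
  ultimately show False using dvd[of "card Q"] by (meson dvd_imp_le not_le)
qed

text \<open>
  A prime ideal that contains \<open>p\<close> and \<open>X ^ N - 1\<close> and avoids the powers of \<open>nonprimitive_product N\<close>
  gives the indeterminate the exact order \<open>N\<close>. Coprimality is indispensable: if \<open>p\<close> divides \<open>N\<close>, then
  \<open>X ^ N - 1\<close> is congruent to the \<open>p\<close>-th power of \<open>X ^ (N div p) - 1\<close>, so that the order is smaller.
\<close>
theorem prime_ideal_with_root_of_unity: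
  assumes N: "N > 1" and p: "prime p" and cop: "coprime p N"
  obtains P :: "int poly set" where
    "mod_prime_ideal P" "of_nat p \<in> P" "monom 1 N - 1 \<in> P"
    "\<And>i. 0 < i \<Longrightarrow> i < N \<Longrightarrow> 1 - monom 1 i \<notin> P"
proof -
  define J :: "int poly set" where "J = {of_nat p * a + (monom 1 N - 1) * b |a b. True}"
  have "ring_ideal J"
    unfolding ring_ideal_def
  proof (intro conjI ballI allI)
    show "0 \<in> J" by (auto simp: J_def intro!: exI[of _ 0])
  next
    fix x y assume "x \<in> J" "y \<in> J"
    then obtain a b a' b' where
      "x = of_nat p * a + (monom 1 N - 1) * b" "y = of_nat p * a' + (monom 1 N - 1) * b'"
      by (auto simp: J_def)
    then have "x + y = of_nat p * (a + a') + (monom 1 N - 1) * (b + b')"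
      by (simp add: algebra_simps)
    then show "x + y \<in> J" unfolding J_def by blast
  next
    fix r x assume "x \<in> J"
    then obtain a b where x: "x = of_nat p * a + (monom 1 N - 1) * b" by (auto simp: J_def)
    have "r * x = of_nat p * (r * a) + (monom 1 N - 1) * (r * b)"
      unfolding x by (simp add: algebra_simps)
    then show "r * x \<in> J" unfolding J_def by blast
  qed
  moreover have "nonprimitive_product N ^ k \<notin> J" for k
  proof
    assume "nonprimitive_product N ^ k \<in> J"
    then have "nonprimitive_product N ^ Suc k \<in> J"
      using \<open>ring_ideal J\<close> by (simp add: ring_ideal_def)
    then show False
      using nonprimitive_product_power_notin[OF assms] by (auto simp: J_def simp del: power_Suc)
  qed
  ultimately obtain P where P: "mod_prime_ideal P" "J \<subseteq> P" "nonprimitive_product N \<notin> P"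
    using prime_ideal_avoiding_powers by blast
  interpret mod_prime_ideal P by fact
  show thesis
  proof
    have "of_nat p * 1 + (monom 1 N - 1) * 0 \<in> J" "of_nat p * 0 + (monom 1 N - 1) * 1 \<in> J"
      unfolding J_def by blast+
    then show "of_nat p \<in> P" "monom 1 N - 1 \<in> P" using P(2) by auto
  next
    fix i assume i: "0 < i" "i < N"
    have "nonprimitive_product N =
        (1 - monom 1 i) * (\<Prod>i\<in>{1..<N} - {i}. 1 - monom 1 i)"
      unfolding nonprimitive_product_def using i by (intro prod.remove) auto
    then show "1 - monom 1 i \<notin> P" using P(3) mult_in' by metis
  qed (fact P(1))
qed

section \<open>The field with \<open>q\<^sup>2\<close> elements as a residue ring\<close>

text \<open>
  The residue ring of \<open>P\<close> is a field with \<open>q\<^sup>2\<close> elements, with primitive element \<open>g\<close>; the map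
  \<open>x \<mapsto> x ^ q\<close> is its involutive automorphism.
\<close>
locale residue_field_square = mod_prime_ideal P for P :: "'r::comm_ring_1 set" +
  fixes g :: 'r and q :: nat
  assumes q_ge: "q \<ge> 2"
    and frob_add: "(x + y) ^ q \<approx> x ^ q + y ^ q"
    and in_or_power: "x \<in> P \<or> (\<exists>i<q\<^sup>2 - 1. x \<approx> g ^ i)"
    and g_order: "g ^ (q\<^sup>2 - 1) \<approx> 1"
    and g_power_inj: "i < q\<^sup>2 - 1 \<Longrightarrow> j < q\<^sup>2 - 1 \<Longrightarrow> g ^ i \<approx> g ^ j \<Longrightarrow> i = j"

text \<open>
  Take \<open>P\<close> with \<open>N = q\<^sup>2 - 1\<close> and \<open>g\<close> the indeterminate. By the freshman's dream, the elements
  with \<open>x ^ q\<^sup>2 \<approx> x\<close> are closed under the ring operations; they include the integers and \<open>g\<close>, hence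
  all polynomials. So every element outside \<open>P\<close> is a root of \<open>Y ^ N - 1\<close>, and the \<open>N\<close> powers of \<open>g\<close>
  leave no room for further roots.
\<close>
theorem residue_field_square_exists:
  assumes "primepow q"
  obtains P :: "int poly set" and g where "residue_field_square P g q"
proof -
  obtain p m where p: "prime p" and m: "m > 0" and q: "q = p ^ m"
    using assms by (auto simp: primepow_def)
  have q2: "q \<ge> 2" using primepow_gt_Suc_0[OF assms] by simp
  have q4: "q\<^sup>2 \<ge> 4" using power_mono[OF q2, of 2] by simp
  define N where "N = q\<^sup>2 - 1"
  have N: "N > 1" "Suc N = q\<^sup>2" using q4 by (auto simp: N_def)
  have "p dvd Suc N" using m by (simp add: N(2) q flip: power_mult)
  then have "coprime p N"
    by (metis coprime_Suc_left_nat coprime_divisors dvd_refl)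
  from prime_ideal_with_root_of_unity[OF N(1) p this] obtain P :: "int poly set" where
    P: "mod_prime_ideal P" "of_nat p \<in> P" "monom 1 N - 1 \<in> P"
    "\<And>i. 0 < i \<Longrightarrow> i < N \<Longrightarrow> 1 - monom 1 i \<notin> P" by blast
  interpret mod_prime_ideal P by fact
  write eqv (infix \<open>\<approx>\<close> 50)
  define g :: "int poly" where "g = monom 1 1"
  have g_power: "g ^ i = monom 1 i" for i by (simp add: g_def monom_power)
  have gN: "g ^ N \<approx> 1" using P(3) by (simp add: eqv_def g_power)
  have g_notin: "g \<notin> P"
    using eqv_in_iff[OF gN] one_notin N(1) by (simp add: power_in_iff)
  have frob: "(x + y) ^ (p ^ k) \<approx> x ^ (p ^ k) + y ^ (p ^ k)" for x y k
    by (rule freshmans_dream_mod_power[OF p P(2)])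
  have pm: "q\<^sup>2 = p ^ (2 * m)" by (simp add: q mult.commute flip: power_mult)
  have frob2: "(x + y) ^ q\<^sup>2 \<approx> x ^ q\<^sup>2 + y ^ q\<^sup>2" for x y
    unfolding pm by (rule frob)
  have fixed_add: "(x + y) ^ q\<^sup>2 \<approx> x + y" if "x ^ q\<^sup>2 \<approx> x" "y ^ q\<^sup>2 \<approx> y" for x y
    using frob2 eqv_add[OF that] by (rule eqv_trans)
  have fixed_diff: "(x - y) ^ q\<^sup>2 \<approx> x - y" if xy: "x ^ q\<^sup>2 \<approx> x" "y ^ q\<^sup>2 \<approx> y" for x y
  proof -
    have "(x - y) ^ q\<^sup>2 = ((x - y) ^ q\<^sup>2 + y ^ q\<^sup>2) - y ^ q\<^sup>2" by simp
    also have "\<dots> \<approx> ((x - y) + y) ^ q\<^sup>2 - y ^ q\<^sup>2"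
      by (rule eqv_diff[OF eqv_sym[OF frob2] eqv_refl])
    also have "\<dots> = x ^ q\<^sup>2 - y ^ q\<^sup>2" by simp
    also have "\<dots> \<approx> x - y" by (rule eqv_diff[OF xy])
    finally show ?thesis .
  qed
  have fixed_mult: "(x * y) ^ q\<^sup>2 \<approx> x * y" if "x ^ q\<^sup>2 \<approx> x" "y ^ q\<^sup>2 \<approx> y" for x y
    unfolding power_mult_distrib by (rule eqv_mult[OF that])
  have fixed_0: "0 ^ q\<^sup>2 \<approx> (0 :: int poly)" using q2 by (simp add: power_0_left)
  have fixed_nat: "(of_nat k) ^ q\<^sup>2 \<approx> (of_nat k :: int poly)" for k
  proof (induction k)
    case (Suc k)
    show ?case using fixed_add[of 1 "of_nat k"] Suc by simp
  qed (use fixed_0 in simp)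
  have fixed_int: "[:c:] ^ q\<^sup>2 \<approx> [:c:]" for c :: int
  proof -
    have "[:c:] = of_nat (nat c) - of_nat (nat (- c))"
      by (simp add: of_nat_poly)
    then show ?thesis using fixed_diff[OF fixed_nat fixed_nat] by simp
  qed
  have fixed_g: "g ^ q\<^sup>2 \<approx> g"
    using eqv_mult[OF eqv_refl[of g] gN] by (simp only: N(2)[symmetric] power_Suc mult_1_right)
  have fixed: "x ^ q\<^sup>2 \<approx> x" for x
  proof (induction x rule: pCons_induct)
    case (pCons c x)
    have "pCons c x = [:c:] + g * x"
      by (simp add: g_def monom_altdef)
    then show ?case using fixed_add[OF fixed_int fixed_mult[OF fixed_g pCons(2)]] by simp
  qed (rule fixed_0)
  have inj_less: "i = j" if "g ^ i \<approx> g ^ j" "i \<le> j" "j < N" for i j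
  proof (rule ccontr)
    assume "i \<noteq> j"
    then have "1 - g ^ (j - i) \<notin> P" using P(4)[of "j - i"] that by (simp add: g_power)
    moreover have "g ^ j = g ^ i * g ^ (j - i)"
      using that by (simp flip: power_add)
    then have "g ^ i * (1 - g ^ (j - i)) \<in> P"
      using that(1) by (simp add: eqv_def algebra_simps)
    ultimately show False using g_notin by (simp add: mult_in_iff power_in_iff)
  qed
  have inj: "i = j" if "i < N" "j < N" "g ^ i \<approx> g ^ j" for i j
    using that inj_less[of i j] inj_less[of j i] eqv_sym by (cases "i \<le> j") auto
  have gen: "x \<in> P \<or> (\<exists>i<N. x \<approx> g ^ i)" for x
  proof (rule ccontr)
    assume no: "\<not> ?thesis"
    define S where "S = insert x ((\<lambda>i. g ^ i) ` {..<N})"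
    have "inj_on (\<lambda>i. g ^ i) {..<N}"
      by (rule inj_onI) (metis eqv_refl inj lessThan_iff)
    then have "card ((\<lambda>i. g ^ i) ` {..<N}) = N" by (simp add: card_image)
    moreover have "x \<notin> (\<lambda>i. g ^ i) ` {..<N}" using no by auto
    ultimately have card: "card S = Suc N" by (simp add: S_def)
    have deg: "degree (monom 1 N - 1 :: int poly poly) \<le> N"
      by (rule degree_diff_le) (auto simp: degree_monom_le)
    \<comment> \<open>The \<open>N + 1\<close> roots in \<open>S\<close> would force even the leading coefficient \<open>1\<close> into \<open>P\<close>.\<close>
    have "coeff (monom 1 N - 1 :: int poly poly) N \<in> P"
    proof (rule coeffs_in_if_many_roots[of _ S])
      show "degree (monom 1 N - 1 :: int poly poly) < card S" using deg card by simp
    next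
      have "x * x ^ N \<approx> x * 1"
        using fixed[of x] by (simp only: N(2)[symmetric] power_Suc mult_1_right)
      then have "x ^ N \<approx> 1" using no by (blast intro: eqv_cancel)
      moreover have "(g ^ i) ^ N \<approx> 1" for i
        using eqv_power[OF gN, of i] by (simp add: mult.commute flip: power_mult)
      ultimately show "poly (monom 1 N - 1) y \<in> P" if "y \<in> S" for y
        using that by (auto simp: S_def eqv_def poly_monom)
    next
      fix y z assume "y \<in> S" "z \<in> S" "y \<noteq> z"
      then show "\<not> y \<approx> z" using no inj by (auto simp: S_def dest: eqv_sym)
    qed
    then show False using N(1) one_notin by simp
  qed
  have "(x + y) ^ q \<approx> x ^ q + y ^ q" for x y
    unfolding q by (rule frob)
  then have "residue_field_square P g q"
    using q2 gen gN inj unfolding N_def by unfold_locales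
  then show thesis by (rule that)
qed

context residue_field_square
begin

lemma order_split: "q\<^sup>2 - 1 = (q - 1) * (q + 1)"
  by (simp add: power2_eq_square algebra_simps)

lemma order_pos: "q\<^sup>2 - 1 > 0"
  using q_ge one_less_power[of q 2] by simp

lemma g_power_order: "g ^ ((q\<^sup>2 - 1) * k) \<approx> 1"
  using eqv_power[OF g_order, of k] by (simp add: power_mult)

lemma g_power_add_order: "g ^ ((q\<^sup>2 - 1) * k + i) \<approx> g ^ i"
  using eqv_mult[OF g_power_order[of k] eqv_refl[of "g ^ i"]] by (simp add: power_add)

lemma g_notin: "g \<notin> P"
  using eqv_in_iff[OF g_order] one_notin order_pos by (simp add: power_in_iff)

lemma frob_diff: "(x - y) ^ q \<approx> x ^ q - y ^ q"
proof -
  have "(x - y) ^ q = ((x - y) ^ q + y ^ q) - y ^ q" by simp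
  also have "\<dots> \<approx> ((x - y) + y) ^ q - y ^ q"
    by (rule eqv_diff[OF eqv_sym[OF frob_add] eqv_refl])
  finally show ?thesis by simp
qed

definition dlog :: "'r \<Rightarrow> nat" where
  "dlog x = (if x \<in> P then 0 else SOME i. i < q\<^sup>2 - 1 \<and> x \<approx> g ^ i)"

text \<open>
  A labelling of the residue classes by the numbers below \<open>q\<^sup>2\<close>; \<open>rep\<close> goes the opposite way.
\<close>
definition idx :: "'r \<Rightarrow> nat" where
  "idx x = (if x \<in> P then 0 else Suc (dlog x))"

definition rep :: "nat \<Rightarrow> 'r" where
  "rep e = (if e = 0 then 0 else g ^ (e - 1))"

text \<open>
  The elements of norm \<open>1\<close>, indexed by the integers modulo \<open>q + 1\<close>.
\<close>
definition u :: "nat \<Rightarrow> 'r" where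
  "u k = g ^ ((q - 1) * k)"

lemma dlog_spec: "x \<notin> P \<Longrightarrow> dlog x < q\<^sup>2 - 1 \<and> x \<approx> g ^ dlog x"
  using someI_ex[of "\<lambda>i. i < q\<^sup>2 - 1 \<and> x \<approx> g ^ i"] in_or_power[of x] by (auto simp: dlog_def)

lemma dlog_eq_iff: "x \<notin> P \<Longrightarrow> y \<notin> P \<Longrightarrow> dlog x = dlog y \<longleftrightarrow> x \<approx> y"
  using dlog_spec[of x] dlog_spec[of y] g_power_inj eqv_sym eqv_trans by metis

lemma idx_less: "idx x < q\<^sup>2"
  using dlog_spec[of x] order_pos q_ge by (auto simp: idx_def)

lemma idx_eq_iff: "idx x = idx y \<longleftrightarrow> x \<approx> y"
proof (cases "x \<in> P \<longleftrightarrow> y \<in> P")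
  case True
  then show ?thesis using dlog_eq_iff[of x y] by (auto simp: idx_def eqv_def intro: diff_in)
next
  case False
  then show ?thesis using eqv_in_iff[of x y] by (auto simp: idx_def)
qed

lemma rep_inj: "e < q\<^sup>2 \<Longrightarrow> e' < q\<^sup>2 \<Longrightarrow> rep e \<approx> rep e' \<Longrightarrow> e = e'"
proof (cases "e = 0 \<or> e' = 0")
  case True
  assume "rep e \<approx> rep e'"
  then show ?thesis
    using True eqv_in_iff[of "rep e" "rep e'"] g_notin q_ge
    by (auto simp: rep_def power_in_iff split: if_splits)
next
  case False
  assume "e < q\<^sup>2" "e' < q\<^sup>2" "rep e \<approx> rep e'"
  moreover from this have "e - 1 < q\<^sup>2 - 1" "e' - 1 < q\<^sup>2 - 1" using False by linarith+
  ultimately have "e - 1 = e' - 1" using False by (intro g_power_inj) (auto simp: rep_def)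
  then show ?thesis using False by linarith
qed

lemma u_add: "u (j + k) = u j * u k"
  by (simp add: u_def power_add distrib_left)

lemma u_period: "u ((q + 1) * k) \<approx> 1"
  using g_power_order[of k] by (simp only: u_def order_split mult.assoc)

lemma u_mod: "u (k mod (q + 1)) \<approx> u k"
proof -
  have "u k = u ((q + 1) * (k div (q + 1))) * u (k mod (q + 1))"
    by (simp only: u_add[symmetric] mult_div_mod_eq)
  also have "\<dots> \<approx> 1 * u (k mod (q + 1))" by (rule eqv_mult[OF u_period eqv_refl])
  finally show ?thesis by (simp add: eqv_sym)
qed

lemma u_inj: "j < q + 1 \<Longrightarrow> k < q + 1 \<Longrightarrow> u j \<approx> u k \<Longrightarrow> j = k"
  using g_power_inj[of "(q - 1) * j" "(q - 1) * k"] q_ge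
    mult_less_mono2[of j "q + 1" "q - 1"] mult_less_mono2[of k "q + 1" "q - 1"]
  unfolding u_def order_split by (simp del: mult_Suc_right add_Suc_right)

lemma u_norm: "u k * u k ^ q \<approx> 1"
proof -
  have "u k * u k ^ q = u ((q + 1) * k)"
    by (simp add: u_def algebra_simps flip: power_add power_mult)
  then show ?thesis using u_period by simp
qed

text \<open>
  Writing the exponent as \<open>(q - 1) * s + r\<close> separates the factor \<open>u s\<close> of norm \<open>1\<close> from
  \<open>g ^ r\<close>.
\<close>
lemma norm_g_power_eqv: "g ^ ((q - 1) * s + r) * (g ^ ((q - 1) * s + r)) ^ q \<approx> g ^ ((q + 1) * r)"
proof -
  have "y * y ^ q = y ^ (q + 1)" for y :: 'r by simp
  then have "g ^ ((q - 1) * s + r) * (g ^ ((q - 1) * s + r)) ^ q = g ^ (((q - 1) * s + r) * (q + 1))"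
    by (simp only: power_mult)
  also have "\<dots> = g ^ ((q\<^sup>2 - 1) * s + (q + 1) * r)"
  proof -
    have "(a * s + r) * b = a * b * s + b * r" for a b :: nat
      by (simp add: algebra_simps)
    then show ?thesis unfolding order_split by (simp only:)
  qed
  also have "\<dots> \<approx> g ^ ((q + 1) * r)" by (rule g_power_add_order)
  finally show ?thesis .
qed

lemma norm_g_power_inj:
  assumes "i < q - 1" "j < q - 1" "g ^ ((q + 1) * i) \<approx> g ^ ((q + 1) * j)"
  shows "i = j"
proof -
  have "(q + 1) * i < q\<^sup>2 - 1" "(q + 1) * j < q\<^sup>2 - 1"
    using mult_less_mono2[OF assms(1), of "q + 1"] mult_less_mono2[OF assms(2), of "q + 1"]
    unfolding order_split mult.commute[of "q - 1"] by simp_all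
  from g_power_inj[OF this assms(3)] show ?thesis unfolding mult_cancel1 by simp
qed

text \<open>
  With \<open>X = x - c\<close> and \<open>d = c' - c\<close> the equations are \<open>X * X ^ q = s\<close> and
  \<open>(X - d) * (X ^ q - d ^ q) = s'\<close>. Multiplying the second one by \<open>X\<close> and replacing \<open>X * X ^ q\<close> by \<open>s\<close>
  gives a quadratic equation for \<open>X\<close> with leading coefficient \<open>d ^ q\<close>.
\<close>
lemma circles_meet_in_at_most_two:
  assumes S: "\<And>x. x \<in> S \<Longrightarrow> (x - c) * (x - c) ^ q \<approx> s"
    and S': "\<And>x. x \<in> S \<Longrightarrow> (x - c') * (x - c') ^ q \<approx> s'"
    and inc: "\<And>x y. x \<in> S \<Longrightarrow> y \<in> S \<Longrightarrow> x \<noteq> y \<Longrightarrow> \<not> x \<approx> y"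
    and ne: "\<not> (c \<approx> c' \<and> s \<approx> s')"
  shows "card S \<le> 2"
proof (rule ccontr)
  assume gt: "\<not> card S \<le> 2"
  then obtain x0 where x0: "x0 \<in> S" by (metis card.empty equals0I le0)
  have "c \<approx> c'"
  proof -
    define d where "d = c' - c"
    have card: "card ((\<lambda>x. x - c) ` S) = card S"
      by (rule card_image) (auto intro: inj_onI)
    have "coeff [:d * s, s' - s - d * d ^ q, d ^ q:] 2 \<in> P"
    proof (rule coeffs_in_if_many_roots[of _ "(\<lambda>x. x - c) ` S"])
      have "degree [:d * s, s' - s - d * d ^ q, d ^ q:] \<le> 2"
        by simp
      then show "degree [:d * s, s' - s - d * d ^ q, d ^ q:] < card ((\<lambda>x. x - c) ` S)"
        using gt card by linarith
    next
      fix X assume "X \<in> (\<lambda>x. x - c) ` S"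
      then obtain x where x: "x \<in> S" "X = x - c" by auto
      define Y where "Y = X ^ q"
      have 1: "X * Y - s \<in> P" using S[OF x(1)] by (simp add: x(2) eqv_def Y_def)
      have "(X - d) * (Y - d ^ q) \<approx> (X - d) * (X - d) ^ q"
        unfolding Y_def by (rule eqv_mult[OF eqv_refl eqv_sym[OF frob_diff]])
      also have "\<dots> \<approx> s'" using S'[OF x(1)] by (simp add: x(2) d_def)
      finally have 2: "(X - d) * (Y - d ^ q) - s' \<in> P" by (simp add: eqv_def)
      have "poly [:d * s, s' - s - d * d ^ q, d ^ q:] X =
          (X - d) * (X * Y - s) - X * ((X - d) * (Y - d ^ q) - s')"
        by (simp add: algebra_simps)
      then show "poly [:d * s, s' - s - d * d ^ q, d ^ q:] X \<in> P"
        using 1 2 by (simp add: diff_in mult_in)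
    next
      fix X Y assume "X \<in> (\<lambda>x. x - c) ` S" "Y \<in> (\<lambda>x. x - c) ` S" "X \<noteq> Y"
      then show "\<not> X \<approx> Y" using inc by (auto simp: eqv_def)
    qed
    then have "d ^ q \<in> P" by (simp add: numeral_2_eq_2)
    then have "c' \<approx> c" by (simp add: d_def eqv_def power_in_iff)
    then show ?thesis by (rule eqv_sym)
  qed
  moreover have "s \<approx> s'"
  proof -
    have "s \<approx> (x0 - c) * (x0 - c) ^ q" using S[OF x0] by (rule eqv_sym)
    also have "\<dots> \<approx> (x0 - c') * (x0 - c') ^ q"
      using \<open>c \<approx> c'\<close> by (intro eqv_mult eqv_power eqv_diff eqv_refl)
    also have "\<dots> \<approx> s'" using S'[OF x0] .
    finally show ?thesis .
  qed
  ultimately show False using ne by blast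
qed

text \<open>
  The index in \<open>U\<close> of the value of a Moebius function at \<open>x = u k\<close>: since \<open>x * x ^ q = 1\<close>,
  \<open>(x - b ^ q) / (1 - b * x) = x * (1 - b * x) ^ q / (1 - b * x) = x * (1 - b * x) ^ (q - 1)\<close>, and
  a power \<open>(g ^ m) ^ (q - 1)\<close> is \<open>u m\<close>. This form shows that the value lies in \<open>U\<close>.
\<close>
definition col :: "'r \<Rightarrow> nat \<Rightarrow> nat" where
  "col b k = (k + dlog (1 - b * u k)) mod (q + 1)"

lemma one_minus_notin:
  assumes b: "\<not> b * b ^ q \<approx> 1"
  shows "1 - b * u k \<notin> P"
proof
  assume "1 - b * u k \<in> P"
  then have 1: "1 \<approx> b * u k" by (simp add: eqv_def)
  have "1 = 1 * (1 :: 'r) ^ q" by simp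
  also have "\<dots> \<approx> (b * u k) * (b * u k) ^ q" by (rule eqv_mult[OF 1 eqv_power[OF 1]])
  also have "\<dots> = (b * b ^ q) * (u k * u k ^ q)" by (simp add: power_mult_distrib algebra_simps)
  also have "\<dots> \<approx> (b * b ^ q) * 1" by (rule eqv_mult[OF eqv_refl u_norm])
  finally show False using b eqv_sym by simp
qed

lemma col_moebius:
  assumes b: "\<not> b * b ^ q \<approx> 1"
  shows "u (col b k) * (1 - b * u k) \<approx> u k - b ^ q"
proof -
  define w where "w = 1 - b * u k"
  have w: "w \<approx> g ^ dlog w" using dlog_spec one_minus_notin[OF b] by (simp add: w_def)
  have "u (col b k) \<approx> u (k + dlog w)" unfolding col_def w_def by (rule u_mod)
  also have "\<dots> = u k * (g ^ dlog w) ^ (q - 1)"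
    by (simp add: u_add) (simp add: u_def mult.commute flip: power_mult)
  also have "\<dots> \<approx> u k * w ^ (q - 1)"
    by (intro eqv_mult eqv_refl eqv_power eqv_sym[OF w])
  finally have "u (col b k) * w \<approx> u k * w ^ (q - 1) * w" by (intro eqv_mult eqv_refl)
  also have "\<dots> = u k * w ^ q"
    using q_ge by (simp add: mult.assoc flip: power_Suc2)
  also have "\<dots> \<approx> u k * (1 ^ q - (b * u k) ^ q)"
    unfolding w_def by (intro eqv_mult eqv_refl frob_diff)
  also have "\<dots> = u k - b ^ q * (u k * u k ^ q)"
    by (simp add: power_mult_distrib algebra_simps)
  also have "\<dots> \<approx> u k - b ^ q * 1"
    by (intro eqv_diff eqv_mult eqv_refl u_norm)
  finally show ?thesis by (simp add: w_def)
qed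

text \<open>
  With \<open>v = u t\<close>, an agreement at \<open>X = u k\<close> means
  \<open>v * (X - b ^ q) * (1 - b' * X) = (X - b' ^ q) * (1 - b * X)\<close>. If this quadratic polynomial is zero,
  its leading and constant coefficients give \<open>b = v * b'\<close> and \<open>b' ^ q = v * b ^ q\<close>; substituted in the
  middle one they give \<open>(v - 1) * (1 - b * b ^ q) = 0\<close>, whence \<open>v = 1\<close> and \<open>b = b'\<close>.
\<close>
lemma columns_agree_at_most_twice:
  assumes b: "\<not> b * b ^ q \<approx> 1" and b': "\<not> b' * b' ^ q \<approx> 1" and ne: "\<not> b \<approx> b'"
    and K: "K \<subseteq> {..<q + 1}"
    and agree: "\<And>k. k \<in> K \<Longrightarrow> (col b k + t) mod (q + 1) = col b' k"
  shows "card K \<le> 2"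
proof (rule ccontr)
  assume gt: "\<not> card K \<le> 2"
  define v where "v = u t"
  define f where "f = [:b' ^ q - v * b ^ q, v * (1 + b ^ q * b') - (1 + b' ^ q * b), b - v * b':]"
  have inj: "inj_on u K"
  proof (rule inj_onI)
    fix j k assume "j \<in> K" "k \<in> K" "u j = u k"
    then show "j = k" using u_inj[of j k] K by auto
  qed
  have coeffs: "coeff f i \<in> P" for i
  proof (rule coeffs_in_if_many_roots[of _ "u ` K"])
    have "degree f \<le> 2" by (simp add: f_def)
    then show "degree f < card (u ` K)" using gt card_image[OF inj] by linarith
  next
    fix X assume "X \<in> u ` K"
    then obtain k where k: "k \<in> K" "X = u k" by auto
    have "v * (X - b ^ q) * (1 - b' * X) \<approx> v * (u (col b k) * (1 - b * X)) * (1 - b' * X)"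
      unfolding k(2) by (intro eqv_mult eqv_refl eqv_sym[OF col_moebius[OF b]])
    also have "\<dots> = u (col b k + t) * (1 - b * X) * (1 - b' * X)"
      by (simp add: v_def u_add algebra_simps)
    also have "\<dots> \<approx> u (col b' k) * (1 - b * X) * (1 - b' * X)"
      unfolding agree[OF k(1), symmetric] by (intro eqv_mult eqv_refl eqv_sym[OF u_mod])
    also have "\<dots> = u (col b' k) * (1 - b' * X) * (1 - b * X)" by (simp add: algebra_simps)
    also have "\<dots> \<approx> (X - b' ^ q) * (1 - b * X)"
      unfolding k(2) by (intro eqv_mult eqv_refl col_moebius[OF b'])
    finally show "poly f X \<in> P" by (simp add: f_def eqv_def algebra_simps)
  next
    fix X Y assume "X \<in> u ` K" "Y \<in> u ` K" "X \<noteq> Y"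
    then show "\<not> X \<approx> Y" using u_inj K by auto
  qed
  have c0: "b' ^ q - v * b ^ q \<in> P" using coeffs[of 0] by (simp add: f_def)
  have c1: "v * (1 + b ^ q * b') - (1 + b' ^ q * b) \<in> P" using coeffs[of 1] by (simp add: f_def)
  have c2: "b - v * b' \<in> P" using coeffs[of 2] by (simp add: f_def numeral_2_eq_2)
  have "(v - 1) * (1 - b * b ^ q) = (v * (1 + b ^ q * b') - (1 + b' ^ q * b))
      + b * (b' ^ q - v * b ^ q) + b ^ q * (b - v * b')"
    by (simp add: algebra_simps)
  also have "\<dots> \<in> P" by (intro add_in mult_in c0 c1 c2)
  finally have "v - 1 \<in> P"
    using b eqv_sym[of 1 "b * b ^ q"] by (auto simp: mult_in_iff eqv_def)
  then have "b' * (v - 1) + (b - v * b') \<in> P" by (intro add_in mult_in c2)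
  then show False using ne by (simp add: eqv_def algebra_simps)
qed

end

section \<open>Arrays and their correlations\<close>

definition array_of :: "nat \<Rightarrow> nat \<Rightarrow> (nat \<times> nat) set \<Rightarrow> nat \<times> nat \<Rightarrow> nat" where
  "array_of \<Lambda> T S = restrict (\<lambda>p. if p \<in> S then 1 else 0) ({..<\<Lambda>} \<times> {..<T})"

lemma array_of_in_binary_arrays: "array_of \<Lambda> T S \<in> binary_arrays \<Lambda> T"
  by (auto simp: array_of_def binary_arrays_def)

lemma array_weight_array_of:
  assumes "S \<subseteq> {..<\<Lambda>} \<times> {..<T}"
  shows "array_weight \<Lambda> T (array_of \<Lambda> T S) = card S"
proof -
  have "{p \<in> {..<\<Lambda>} \<times> {..<T}. array_of \<Lambda> T S p = 1} = S"
    using assms by (auto simp: array_of_def)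
  then show ?thesis by (simp add: array_weight_def)
qed

lemma correlation_array_of:
  assumes "S \<subseteq> {..<\<Lambda>} \<times> {..<T}"
  shows "correlation \<Lambda> T (array_of \<Lambda> T S) (array_of \<Lambda> T S') t =
    card {p \<in> S. (fst p, (snd p + t) mod T) \<in> S'}"
proof -
  let ?box = "{..<\<Lambda>} \<times> {..<T}"
  have "correlation \<Lambda> T (array_of \<Lambda> T S) (array_of \<Lambda> T S') t =
      (\<Sum>p\<in>?box. array_of \<Lambda> T S p * array_of \<Lambda> T S' (fst p, (snd p + t) mod T))"
    unfolding correlation_def by (simp add: sum.cartesian_product case_prod_beta)
  also have "\<dots> = (\<Sum>p\<in>?box. if p \<in> {p \<in> S. (fst p, (snd p + t) mod T) \<in> S'} then 1 else 0)"
    by (rule sum.cong) (auto simp: array_of_def)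
  also have "\<dots> = card (?box \<inter> {p \<in> S. (fst p, (snd p + t) mod T) \<in> S'})"
    by (simp add: sum.If_cases)
  also have "?box \<inter> {p \<in> S. (fst p, (snd p + t) mod T) \<in> S'} =
      {p \<in> S. (fst p, (snd p + t) mod T) \<in> S'}"
    using assms by auto
  finally show ?thesis .
qed

text \<open>
  For graphs, a correlation counts at most the parameters \<open>k\<close> whose entry, after the shift, is
  an entry of the second graph.
\<close>
lemma correlation_graphs_le:
  fixes row col row' col' :: "nat \<Rightarrow> nat"
  assumes "\<And>k. k < w \<Longrightarrow> row k < \<Lambda> \<and> col k < T"
  shows "correlation \<Lambda> T (array_of \<Lambda> T ((\<lambda>k. (row k, col k)) ` {..<w}))
      (array_of \<Lambda> T ((\<lambda>k. (row' k, col' k)) ` {..<w})) t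
    \<le> card {k \<in> {..<w}. \<exists>k'<w. row' k' = row k \<and> col' k' = (col k + t) mod T}"
    (is "_ \<le> card ?K")
proof -
  let ?S = "(\<lambda>k. (row k, col k)) ` {..<w}" and ?S' = "(\<lambda>k. (row' k, col' k)) ` {..<w}"
  have "{p \<in> ?S. (fst p, (snd p + t) mod T) \<in> ?S'} \<subseteq> (\<lambda>k. (row k, col k)) ` ?K"
    by force
  moreover have "finite ?K" by (rule finite_subset[of _ "{..<w}"]) auto
  ultimately have "card {p \<in> ?S. (fst p, (snd p + t) mod T) \<in> ?S'} \<le> card ?K"
    by (intro surj_card_le)
  then show ?thesis
    by (subst correlation_array_of) (use assms in auto)
qed

section \<open>The code over a residue field\<close>

context residue_field_square
begin

definition point :: "nat \<Rightarrow> nat \<Rightarrow> nat \<Rightarrow> 'r" where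
  "point e i k = rep e + g ^ i * u k"

definition twist :: "nat \<Rightarrow> nat \<Rightarrow> 'r" where
  "twist s r = g ^ ((q - 1) * s + r)"

text \<open>
  The row with index \<open>q\<^sup>2\<close> stays empty; it stands for the point at infinity of the inversive plane,
  which lies on none of the circles.
\<close>
definition codeword :: "nat \<times> nat \<times> nat \<times> nat \<Rightarrow> nat \<times> nat \<Rightarrow> nat" where
  "codeword = (\<lambda>(e, i, s, r). array_of (q\<^sup>2 + 1) (q + 1)
     ((\<lambda>k. (idx (point e i k), col (twist s r) k)) ` {..<q + 1}))"

text \<open>
  The components are the centre, the radius and the two parts \<open>s\<close>, \<open>r\<close> of the exponent of
  \<open>b = twist s r\<close>. Excluding \<open>r = 0\<close> excludes exactly the \<open>b\<close> of norm \<open>1\<close>; \<open>i < q - 1\<close> makes the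
  circle radii \<open>g ^ ((q + 1) * i)\<close> distinct.
\<close>
definition params :: "(nat \<times> nat \<times> nat \<times> nat) set" where
  "params = {..<q\<^sup>2} \<times> {..<q - 1} \<times> {..<q + 1} \<times> {1..<q - 1}"

lemma point_inj:
  assumes "j < q + 1" "k < q + 1" "point e i j \<approx> point e i k"
  shows "j = k"
proof -
  have "g ^ i * (u j - u k) \<in> P"
    using assms(3) by (simp add: point_def eqv_def algebra_simps)
  then have "u j \<approx> u k" by (simp add: mult_in_iff power_in_iff g_notin eqv_def)
  then show ?thesis using u_inj assms by blast
qed

lemma point_on_circle:
  assumes "x \<approx> point e i k"
  shows "(x - rep e) * (x - rep e) ^ q \<approx> g ^ ((q + 1) * i)"
proof -
  have "x - rep e \<approx> point e i k - rep e" by (rule eqv_diff[OF assms eqv_refl])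
  then have 1: "x - rep e \<approx> g ^ i * u k" by (simp add: point_def)
  have "(x - rep e) * (x - rep e) ^ q \<approx> (g ^ i * u k) * (g ^ i * u k) ^ q"
    by (intro eqv_mult eqv_power 1)
  also have "\<dots> = (g ^ i * (g ^ i) ^ q) * (u k * u k ^ q)"
    by (simp add: power_mult_distrib mult_ac)
  also have "\<dots> \<approx> g ^ ((q + 1) * i) * 1"
    using norm_g_power_eqv[of 0 i] by (intro eqv_mult u_norm) simp
  finally show ?thesis by simp
qed

lemma twist_norm:
  assumes "r \<in> {1..<q - 1}"
  shows "\<not> twist s r * twist s r ^ q \<approx> 1"
proof
  assume "twist s r * twist s r ^ q \<approx> 1"
  then have "g ^ ((q + 1) * r) \<approx> 1"
    using norm_g_power_eqv[of s r] eqv_sym eqv_trans unfolding twist_def by blast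
  then have "g ^ ((q + 1) * r) \<approx> g ^ ((q + 1) * 0)" by simp
  then have "r = 0" using assms by (intro norm_g_power_inj) auto
  then show False using assms by simp
qed

lemma twist_inj:
  assumes "s < q + 1" "s' < q + 1" "r < q - 1" "r' < q - 1" "twist s r \<approx> twist s' r'"
  shows "s = s' \<and> r = r'"
proof -
  have less: "(q - 1) * s + r < q\<^sup>2 - 1" if "s < q + 1" "r < q - 1" for s r
  proof -
    have "(q - 1) * s + r < (q - 1) * Suc s" using that by simp
    also have "\<dots> \<le> (q - 1) * (q + 1)" using that by (intro mult_le_mono2) simp
    finally show ?thesis unfolding order_split .
  qed
  have eq: "(q - 1) * s + r = (q - 1) * s' + r'"
    using assms by (intro g_power_inj less) (simp_all add: twist_def)
  have "((q - 1) * s + r) div (q - 1) = s" "((q - 1) * s' + r') div (q - 1) = s'"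
    using assms by simp_all
  with eq show ?thesis by simp
qed

lemma entry_in_range:
  "idx (point e i k) < q\<^sup>2 + 1 \<and> col b k < q + 1"
  using idx_less[of "point e i k"] by (simp add: col_def)

lemma entries_inj: "inj_on (\<lambda>k. (idx (point e i k), col b k)) {..<q + 1}"
  by (rule inj_onI) (auto simp: idx_eq_iff intro: point_inj)

lemma codeword_weight: "array_weight (q\<^sup>2 + 1) (q + 1) (codeword x) = q + 1"
proof -
  obtain e i s r where x: "x = (e, i, s, r)" by (metis prod_cases4)
  have "array_weight (q\<^sup>2 + 1) (q + 1) (codeword x) =
      card ((\<lambda>k. (idx (point e i k), col (twist s r) k)) ` {..<q + 1})"
    unfolding codeword_def x prod.case
    by (rule array_weight_array_of) (use entry_in_range in blast)
  also have "\<dots> = q + 1" unfolding card_image[OF entries_inj] by simp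
  finally show ?thesis .
qed

text \<open>
  Two entries in the same row are equal, and a shift by \<open>0 < t < q + 1\<close> changes the column.
\<close>
lemma codeword_autocorrelation:
  assumes "t \<in> {1..<q + 1}"
  shows "correlation (q\<^sup>2 + 1) (q + 1) (codeword x) (codeword x) t = 0"
proof -
  obtain e i s r where x: "x = (e, i, s, r)" by (metis prod_cases4)
  let ?c = "col (twist s r)"
  have "{k \<in> {..<q + 1}. \<exists>k'<q + 1. idx (point e i k') = idx (point e i k) \<and>
      ?c k' = (?c k + t) mod (q + 1)} = {}" (is "?K = {}")
  proof (rule equals0I)
    fix k assume "k \<in> ?K"
    then obtain k' where k: "k < q + 1" "k' < q + 1" "idx (point e i k') = idx (point e i k)"
      "?c k' = (?c k + t) mod (q + 1)" by blast
    then have "k' = k" using point_inj by (simp add: idx_eq_iff)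
    then have "(?c k + t) mod (q + 1) = ?c k mod (q + 1)" using k by (simp add: col_def)
    then have "(q + 1) dvd t" by (metis add_diff_cancel_left' le_add1 mod_eq_dvd_iff_nat)
    then show False using assms by (auto dest: dvd_imp_le)
  qed
  moreover have "correlation (q\<^sup>2 + 1) (q + 1) (codeword x) (codeword x) t \<le> card ?K"
    unfolding codeword_def x prod.case by (rule correlation_graphs_le) (rule entry_in_range)
  ultimately show ?thesis unfolding \<open>?K = {}\<close> by simp
qed

lemma codeword_crosscorrelation:
  assumes x: "x \<in> params" and y: "y \<in> params" and ne: "x \<noteq> y"
  shows "correlation (q\<^sup>2 + 1) (q + 1) (codeword x) (codeword y) t \<le> 2"
proof -
  obtain e i s r where x': "x = (e, i, s, r)" by (metis prod_cases4)
  obtain e' i' s' r' where y': "y = (e', i', s', r')" by (metis prod_cases4)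
  let ?c = "col (twist s r)" and ?c' = "col (twist s' r')"
  define K where "K = {k \<in> {..<q + 1}. \<exists>k'<q + 1.
    idx (point e' i' k') = idx (point e i k) \<and> ?c' k' = (?c k + t) mod (q + 1)}"
  have "card K \<le> 2"
  proof (cases "e = e' \<and> i = i'")
    case False
    have inj: "inj_on (point e i) K"
    proof (rule inj_onI)
      fix j k assume "j \<in> K" "k \<in> K" "point e i j = point e i k"
      then show "j = k" using point_inj[of j k e i] by (simp add: K_def)
    qed
    have "card (point e i ` K) \<le> 2"
    proof (rule circles_meet_in_at_most_two)
      fix z assume "z \<in> point e i ` K"
      then obtain k k' where "z = point e i k" "idx (point e' i' k') = idx (point e i k)"
        by (auto simp: K_def)
      then have "z \<approx> point e i k" "z \<approx> point e' i' k'"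
        by (auto simp: idx_eq_iff intro: eqv_sym)
      then show "(z - rep e) * (z - rep e) ^ q \<approx> g ^ ((q + 1) * i)"
        and "(z - rep e') * (z - rep e') ^ q \<approx> g ^ ((q + 1) * i')"
        by (blast intro: point_on_circle)+
    next
      fix z z' assume "z \<in> point e i ` K" "z' \<in> point e i ` K" "z \<noteq> z'"
      then show "\<not> z \<approx> z'" using point_inj by (auto simp: K_def)
    next
      show "\<not> (rep e \<approx> rep e' \<and> g ^ ((q + 1) * i) \<approx> g ^ ((q + 1) * i'))"
        using False x y rep_inj norm_g_power_inj unfolding x' y' params_def by blast
    qed
    then show ?thesis by (simp add: card_image[OF inj])
  next
    case True
    then have "\<not> twist s r \<approx> twist s' r'"
      using ne x y twist_inj[of s s' r r'] by (auto simp: x' y' params_def)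
    moreover have "(?c k + t) mod (q + 1) = ?c' k" if "k \<in> K" for k
    proof -
      from that obtain k' where k: "k < q + 1" "k' < q + 1"
        "idx (point e i k') = idx (point e i k)" "?c' k' = (?c k + t) mod (q + 1)"
        using True by (auto simp: K_def)
      then have "k' = k" using point_inj by (simp add: idx_eq_iff)
      with k show ?thesis by simp
    qed
    moreover have "\<not> twist s r * twist s r ^ q \<approx> 1" "\<not> twist s' r' * twist s' r' ^ q \<approx> 1"
      using x y by (auto simp: x' y' params_def intro!: twist_norm)
    moreover have "K \<subseteq> {..<q + 1}" by (auto simp: K_def)
    ultimately show ?thesis by (intro columns_agree_at_most_twice) auto
  qed
  moreover have "correlation (q\<^sup>2 + 1) (q + 1) (codeword x) (codeword y) t \<le> card K"
    unfolding codeword_def x' y' prod.case K_def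
    by (rule correlation_graphs_le) (rule entry_in_range)
  ultimately show ?thesis by linarith
qed

text \<open>
  If two different parameters gave the same array, its weight \<open>q + 1 \<ge> 3\<close> would be a
  cross-correlation, which is at most \<open>2\<close>.
\<close>
lemma codeword_inj: "inj_on codeword params"
proof (rule inj_onI, rule ccontr)
  fix x y assume xy: "x \<in> params" "y \<in> params" "codeword x = codeword y" "x \<noteq> y"
  obtain e i s r where x: "x = (e, i, s, r)" by (metis prod_cases4)
  let ?S = "(\<lambda>k. (idx (point e i k), col (twist s r) k)) ` {..<q + 1}"
  have S: "?S \<subseteq> {..<q\<^sup>2 + 1} \<times> {..<q + 1}" using entry_in_range by auto
  have "correlation (q\<^sup>2 + 1) (q + 1) (codeword x) (codeword x) 0 =
      card {p \<in> ?S. (fst p, (snd p + 0) mod (q + 1)) \<in> ?S}"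
    unfolding codeword_def x prod.case by (rule correlation_array_of[OF S])
  also have "{p \<in> ?S. (fst p, (snd p + 0) mod (q + 1)) \<in> ?S} = ?S" using S by auto
  also have "card ?S = q + 1" unfolding card_image[OF entries_inj] by simp
  finally show False
    using codeword_crosscorrelation[OF xy(1,2,4), of 0] xy(3) q_ge by simp
qed

lemma codewords_ideal_ooc: "ideal_ooc_2d (q\<^sup>2 + 1) (q + 1) (q + 1) 2 (codeword ` params)"
  unfolding ideal_ooc_2d_def ooc_2d_def
proof (intro conjI ballI impI)
  show "codeword ` params \<subseteq> binary_arrays (q\<^sup>2 + 1) (q + 1)"
    by (auto simp: codeword_def intro: array_of_in_binary_arrays)
next
  fix A assume "A \<in> codeword ` params"
  then show "array_weight (q\<^sup>2 + 1) (q + 1) A = q + 1"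
    by (auto simp only: codeword_weight)
next
  fix A t assume "A \<in> codeword ` params" "t \<in> {1..<q + 1}"
  then show "correlation (q\<^sup>2 + 1) (q + 1) A A t \<le> 0"
    using codeword_autocorrelation by auto
next
  fix A B t assume "A \<in> codeword ` params" "B \<in> codeword ` params" "A \<noteq> B"
  then show "correlation (q\<^sup>2 + 1) (q + 1) A B t \<le> 2"
    using codeword_crosscorrelation by blast
qed

lemma card_codewords: "card (codeword ` params) = q\<^sup>2 * (q - 1) * (q + 1) * (q - 2)"
proof -
  have "card params = q\<^sup>2 * ((q - 1) * ((q + 1) * (q - 1 - 1)))"
    by (simp only: params_def card_cartesian_product card_lessThan card_atLeastLessThan)
  moreover have "q - 1 - 1 = q - 2" by simp
  ultimately show ?thesis by (simp only: card_image[OF codeword_inj] mult.assoc)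
qed

end

section \<open>Comparison with the Johnson bound\<close>

text \<open>
  For these parameters every intermediate quotient is an integer, so all floors disappear.
\<close>
lemma johnson_bound_value:
  assumes q: "q \<ge> 2"
  shows "johnson_bound_ideal (q\<^sup>2 + 1) (q + 1) (q + 1) 2 = int (q * (q\<^sup>2 + 1) * (q + 1)\<^sup>2)"
proof -
  define x where "x = real q"
  have x: "x \<ge> 2" using q by (simp add: x_def)
  have 1: "((x\<^sup>2 + 1) * (x + 1) - 2 * (x + 1)) / (x + 1 - 2) = (x + 1)\<^sup>2"
    using x by (simp add: field_simps power2_eq_square)
  have 2: "((x\<^sup>2 + 1) * (x + 1) - (x + 1)) / (x + 1 - 1) * (x + 1)\<^sup>2 = x * (x + 1) ^ 3"
    using x by (simp add: field_simps power2_eq_square power3_eq_cube)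
  have 3: "((x\<^sup>2 + 1) * (x + 1)) / ((x + 1) * (x + 1)) * (x * (x + 1) ^ 3) =
      x * (x\<^sup>2 + 1) * (x + 1)\<^sup>2"
    using x by (simp add: divide_simps) (simp add: power2_eq_square power3_eq_cube algebra_simps)
  have r: "real (q\<^sup>2 + 1) = x\<^sup>2 + 1" "real (q + 1) = x + 1" by (simp_all add: x_def)
  have i: "real_of_int (int ((q + 1)\<^sup>2)) = (x + 1)\<^sup>2"
    "real_of_int (int (q * (q + 1) ^ 3)) = x * (x + 1) ^ 3"
    "real_of_int (int (q * (q\<^sup>2 + 1) * (q + 1)\<^sup>2)) = x * (x\<^sup>2 + 1) * (x + 1)\<^sup>2"
    by (simp_all only: x_def of_int_of_nat_eq of_nat_mult of_nat_power of_nat_add of_nat_1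
        of_int_mult of_int_power of_int_add of_int_1)
  have f1: "\<lfloor>(x + 1)\<^sup>2\<rfloor> = int ((q + 1)\<^sup>2)"
    by (simp only: i(1)[symmetric] floor_of_int)
  have f2: "\<lfloor>x * (x + 1) ^ 3\<rfloor> = int (q * (q + 1) ^ 3)"
    by (simp only: i(2)[symmetric] floor_of_int)
  have f3: "\<lfloor>x * (x\<^sup>2 + 1) * (x + 1)\<^sup>2\<rfloor> = int (q * (q\<^sup>2 + 1) * (q + 1)\<^sup>2)"
    by (simp only: i(3)[symmetric] floor_of_int)
  show ?thesis
    unfolding johnson_bound_ideal_2 r 1 f1 i(1) 2 f2 i(2) 3 f3 ..
qed

theorem theorem3p5:
  shows "\<exists>C :: nat \<Rightarrow> (nat \<times> nat \<Rightarrow> nat) set.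
    (\<forall>q. primepow q \<longrightarrow> ideal_ooc_2d (q\<^sup>2 + 1) (q + 1) (q + 1) 2 (C q)) \<and>
    ((\<lambda>q. real (card (C q)) / real_of_int (johnson_bound_ideal (q\<^sup>2 + 1) (q + 1) (q + 1) 2))
       \<longlongrightarrow> 1) (inf at_top (principal {q. primepow q}))"
proof -
  have "\<exists>C. primepow q \<longrightarrow> ideal_ooc_2d (q\<^sup>2 + 1) (q + 1) (q + 1) 2 C \<and>
      card C = q\<^sup>2 * (q - 1) * (q + 1) * (q - 2)" for q :: nat
  proof (cases "primepow q")
    case True
    then obtain P :: "int poly set" and g where "residue_field_square P g q"
      by (rule residue_field_square_exists)
    then interpret residue_field_square P g q .
    show ?thesis using codewords_ideal_ooc card_codewords by blast
  qed simp
  then obtain C where C: "\<And>q. primepow q \<Longrightarrow> ideal_ooc_2d (q\<^sup>2 + 1) (q + 1) (q + 1) 2 (C q)"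
    and card: "\<And>q. primepow q \<Longrightarrow> card (C q) = q\<^sup>2 * (q - 1) * (q + 1) * (q - 2)"
    by metis
  let ?F = "inf at_top (principal {q :: nat. primepow q})"
  define h where "h x = x\<^sup>2 * (x - 1) * (x + 1) * (x - 2) / (x * (x\<^sup>2 + 1) * (x + 1)\<^sup>2)" for x :: real
  have "(h \<longlongrightarrow> 1) at_top" unfolding h_def by real_asymp
  then have "((\<lambda>q. h (real q)) \<longlongrightarrow> 1) at_top"
    by (rule filterlim_compose[OF _ filterlim_real_sequentially])
  then have "((\<lambda>q. h (real q)) \<longlongrightarrow> 1) ?F" by (rule tendsto_mono[OF inf_le1])
  moreover have "\<forall>\<^sub>F q in ?F. h (real q) = real (card (C q)) /
      real_of_int (johnson_bound_ideal (q\<^sup>2 + 1) (q + 1) (q + 1) 2)"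
    unfolding eventually_inf_principal
  proof (intro always_eventually allI impI)
    fix q :: nat assume "q \<in> {q. primepow q}"
    then have q: "primepow q" by simp
    then have q2: "q \<ge> 2" using primepow_gt_Suc_0 by fastforce
    then have "real (q - 1) = real q - 1" "real (q - 2) = real q - 2" by simp_all
    then have "real (card (C q)) = (real q)\<^sup>2 * (real q - 1) * (real q + 1) * (real q - 2)"
      by (simp only: card[OF q] of_nat_mult of_nat_power of_nat_add of_nat_1)
    moreover have "real_of_int (johnson_bound_ideal (q\<^sup>2 + 1) (q + 1) (q + 1) 2) =
        real q * ((real q)\<^sup>2 + 1) * (real q + 1)\<^sup>2"
      by (simp only: johnson_bound_value[OF q2] of_int_of_nat_eq of_nat_mult of_nat_power
          of_nat_add of_nat_1 of_int_mult of_int_power of_int_add of_int_1)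
    ultimately show "h (real q) = real (card (C q)) /
        real_of_int (johnson_bound_ideal (q\<^sup>2 + 1) (q + 1) (q + 1) 2)"
      by (simp only: h_def)
  qed
  ultimately have "((\<lambda>q. real (card (C q)) /
      real_of_int (johnson_bound_ideal (q\<^sup>2 + 1) (q + 1) (q + 1) 2)) \<longlongrightarrow> 1) ?F"
    by (rule Lim_transform_eventually)
  with C show ?thesis by blast
qed

end
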